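(* For every integer $n\geq 1$, the set $\mathcal{C}_n$ of metallic mean Wang tiles admits no periodic tiling, i.e. no valid configuration $w:\mathbb{Z}^2\to\mathcal{C}_n$ is periodic.
   Context: A Wang tile is a tuple $(a,b,c,d)$ where $a,b,c,d$ are the labels of the right (east), top (north), left (west) and bottom (south) edges of a unit square. For a finite set $\mathcal{T}$ of Wang tiles, a configuration $w:\mathbb{Z}^2\to\mathcal{T}$ is valid if for all $m\in\mathbb{Z}^2$ the east label of $w_m$ equals the west label of $w_{m+(1,0)}$ and the north label of $w_m$ equals the south label of $w_{m+(0,1)}$. It is periodic if there is $p\in\mathbb{Z}^2\setminus\{0\}$ with $w_{m+p}=w_m$ for all $m$. Metallic mean Wang tiles. For an integer $n\ge1$ let $$V_n=\{(v_0,v_1,v_2)\in\mathbb{N}^3: 0\le v_0\le v_1\le 1,\ v_1\le v_2\le n+1\}$$ (with $0\in\mathbb{N}$), and define $\theta_n:V_n\times V_n\to\mathbb{Z}^3$, $\theta_n((u_0,u_1,u_2),(v_0,v_1,v_2))=(r_0,r_1,r_2)$, by $r_0=u_0$; $r_1=v_2-n$ if $u_0=0$ and $r_1=1$ if $u_0=1$; $r_2=v_1+u_0$ if $v_0=0$ and $r_2=u_2+1$ if $v_0=1$. Then $$\mathcal{C}_n=\{(\theta_n(u,v),\theta_n(v,u),u,v): u,v\in V_n,\ \theta_n(u,v)\in V_n,\ \theta_n(v,u)\in V_n\},$$ where tuples are (east, north, west, south). *)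

theory Defs
  imports Main "HOL-Library.Product_Plus"
begin

(* Components in the order (east, north, west, south). *)
type_synonym 'c wang_tile = "'c \<times> 'c \<times> 'c \<times> 'c"

fun east :: "'c wang_tile \<Rightarrow> 'c" where "east (a, b, c, d) = a"
fun north :: "'c wang_tile \<Rightarrow> 'c" where "north (a, b, c, d) = b"
fun west :: "'c wang_tile \<Rightarrow> 'c" where "west (a, b, c, d) = c"
fun south :: "'c wang_tile \<Rightarrow> 'c" where "south (a, b, c, d) = d"

definition valid_configuration ::
    "'c wang_tile set \<Rightarrow> (int \<times> int \<Rightarrow> 'c wang_tile) \<Rightarrow> bool" where
  "valid_configuration T w \<longleftrightarrow>
     (\<forall>m. w m \<in> T) \<and>
     (\<forall>m. east (w m) = west (w (m + (1, 0)))) \<and>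
     (\<forall>m. north (w m) = south (w (m + (0, 1))))"

definition periodic :: "(int \<times> int \<Rightarrow> 'a) \<Rightarrow> bool" where
  "periodic w \<longleftrightarrow> (\<exists>p. p \<noteq> 0 \<and> (\<forall>m. w (m + p) = w m))"

(* V n is a set of triples of natural numbers, but it is realised inside int ^ 3: theta n takes
   values there (the second component below may be negative), and the tiles require them to lie
   in V n. *)
definition V :: "nat \<Rightarrow> (int \<times> int \<times> int) set" where
  "V n = {(v0, v1, v2). 0 \<le> v0 \<and> v0 \<le> v1 \<and> v1 \<le> 1 \<and> v1 \<le> v2 \<and> v2 \<le> int n + 1}"

(* Only the values on V n \<times> V n matter; there the first components are 0 or 1, so
   each else-branch is the case of first component 1. *)
fun theta :: "nat \<Rightarrow> int \<times> int \<times> int \<Rightarrow> int \<times> int \<times> int \<Rightarrow> int \<times> int \<times> int" where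
  "theta n (u0, u1, u2) (v0, v1, v2) =
     (u0,
      if u0 = 0 then v2 - int n else 1,
      if v0 = 0 then v1 + u0 else u2 + 1)"

definition metallic_mean_tiles :: "nat \<Rightarrow> (int \<times> int \<times> int) wang_tile set" where
  "metallic_mean_tiles n =
     {(theta n u v, theta n v u, u, v) | u v.
        u \<in> V n \<and> v \<in> V n \<and> theta n u v \<in> V n \<and> theta n v u \<in> V n}"

end

theory Submission
  imports Defs
begin

text \<open>
  The first component of the west label is constant along each row and that of the south label
  along each column, so a configuration determines a 0-1 sequence \<open>a\<close> indexed by rows and a
  0-1 sequence \<open>b\<close> indexed by columns. On each tile, with west label \<open>u\<close>, south label \<open>v\<close>, east
  label \<open>r\<close> and north label \<open>s\<close>,
  \[ (r_1 - u_1) + (s_2 - v_2) = (1 - u_0) (v_0 - n) + u_0, \]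
  and the same holds with the two axes exchanged. Summed over an \<open>N\<close> by \<open>N\<close> square, the left-hand
  side telescopes to \<open>O(N)\<close>, while the right-hand side is \<open>(N - \<alpha>) (\<beta> - n N) + N \<alpha>\<close>, where
  \<open>\<alpha>\<close> and \<open>\<beta>\<close> are the partial sums of \<open>a\<close> and \<open>b\<close>. Comparing the two versions gives
  \<open>\<alpha> - \<beta> = O(1)\<close>, so the density \<open>x\<close> of \<open>a\<close> (or \<open>b\<close>) satisfies \<open>x^2 - (n + 2) x + n = 0\<close>, whose
  discriminant \<open>n^2 + 4\<close> is not a square. But a period of the configuration makes \<open>a\<close> or \<open>b\<close>
  periodic, hence its density rational.
\<close>

text \<open>Such an \<open>m\<close> would lie strictly between \<open>n\<close> and
  \<open>n + 2\<close>, and \<open>m = n + 1\<close> fails by parity.\<close>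

lemma square_plus_four_not_square:
  fixes n m :: int
  assumes "n \<ge> 1" "m \<ge> 0"
  shows "m\<^sup>2 \<noteq> n\<^sup>2 + 4"
proof
  assume eq: "m\<^sup>2 = n\<^sup>2 + 4"
  have "n < m"
    using eq assms by (intro power_less_imp_less_base[of n 2 m]) auto
  moreover have "m\<^sup>2 < (n + 2)\<^sup>2"
    using eq assms by (simp add: power2_sum)
  then have "m < n + 2"
    using assms by (intro power_less_imp_less_base[of m 2 "n + 2"]) auto
  ultimately have "m = n + 1" by simp
  then have "2 * n = 3"
    using eq by (simp add: power2_eq_square algebra_simps)
  then show False by presburger
qed

text \<open>Completing the square, a root \<open>x / q\<close> would make
  \<open>(n^2 + 4) * q^2\<close> a perfect square, hence also \<open>n^2 + 4\<close>.\<close>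

lemma metallic_quadratic_no_rational_root:
  fixes n q x :: int
  assumes "n \<ge> 1" "q > 0"
  shows "x\<^sup>2 - (n + 2) * q * x + n * q\<^sup>2 \<noteq> 0"
proof
  assume "x\<^sup>2 - (n + 2) * q * x + n * q\<^sup>2 = 0"
  then have eq: "(2 * x - (n + 2) * q)\<^sup>2 = (n\<^sup>2 + 4) * q\<^sup>2"
    by (simp add: power2_eq_square algebra_simps)
  then have "q\<^sup>2 dvd (2 * x - (n + 2) * q)\<^sup>2" by simp
  then have "q dvd 2 * x - (n + 2) * q" by simp
  then obtain m where "2 * x - (n + 2) * q = q * m" by (elim dvdE)
  then have "m\<^sup>2 * q\<^sup>2 = (n\<^sup>2 + 4) * q\<^sup>2"
    using eq by (simp add: power_mult_distrib mult.commute)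
  then have "\<bar>m\<bar>\<^sup>2 = n\<^sup>2 + 4"
    using assms by simp
  then show False
    using square_plus_four_not_square[of n "\<bar>m\<bar>"] assms by simp
qed

lemma sum_lessThan_mult_periodic:
  fixes f :: "nat \<Rightarrow> int"
  assumes "\<And>j. f (j + q) = f j"
  shows "(\<Sum>j<k * q. f j) = int k * (\<Sum>j<q. f j)"
proof (induction k)
  case (Suc k)
  have shift: "f (j + k * q) = f j" for j
  proof (induction k)
    case (Suc k)
    then show ?case
      using assms[of "j + k * q"] by (simp add: ac_simps)
  qed simp
  have "(\<Sum>j<m + r. f j) = (\<Sum>j<m. f j) + (\<Sum>j<r. f (j + m))" for m r
    by (induction r) (simp_all add: add.commute)
  from this[of "k * q" q]
  have "(\<Sum>j<Suc k * q. f j) = (\<Sum>j<k * q. f j) + (\<Sum>j<q. f (j + k * q))"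
    by (simp add: add.commute)
  then show ?case
    using Suc shift by (simp add: algebra_simps)
qed simp

text \<open>The two bounds tie the partial sums of \<open>b\<close> to those of \<open>a\<close>, so
  a period of \<open>a\<close> alone yields a rational root \<open>x / q\<close> of the
  quadratic.\<close>

lemma no_periodic_balanced_sequences:
  fixes a b :: "nat \<Rightarrow> int" and n C :: int and q :: nat
  assumes n: "n \<ge> 1" and q: "q > 0"
    and period: "\<And>j. a (j + q) = a j"
    and a: "\<And>j. a j \<in> {0, 1}"
    and bound_a: "\<And>N. \<bar>(int N - (\<Sum>j<N. a j)) * ((\<Sum>i<N. b i) - n * int N)
          + int N * (\<Sum>j<N. a j)\<bar> \<le> C * int N"
    and bound_b: "\<And>N. \<bar>(int N - (\<Sum>i<N. b i)) * ((\<Sum>j<N. a j) - n * int N)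
          + int N * (\<Sum>i<N. b i)\<bar> \<le> C * int N"
  shows False
proof -
  define x where "x = (\<Sum>j<q. a j)"
  define X where "X = x\<^sup>2 - (n + 2) * int q * x + n * (int q)\<^sup>2"
  have "C \<ge> 0" using bound_a[of 1] by simp
  \<comment> \<open>With \<open>N\<close> a multiple of \<open>q\<close> the density of
    \<open>a\<close> is exact. The errors below total \<open>3 * C * N\<close>, and \<open>k\<close>
    is just large enough for them to force the integer \<open>X\<close> to vanish.\<close>
  define k where "k = nat (3 * C * int q + 1)"
  define N where "N = k * q"
  define \<alpha> where "\<alpha> = (\<Sum>j<N. a j)"
  define \<beta> where "\<beta> = (\<Sum>i<N. b i)"
  have k: "int k = 3 * C * int q + 1"
    using \<open>C \<ge> 0\<close> by (simp add: k_def)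
  then have "int N > 0"
    using q \<open>C \<ge> 0\<close> by (simp add: N_def add_nonneg_pos)
  have \<alpha>: "\<alpha> = int k * x"
    using sum_lessThan_mult_periodic[of a q k] period by (simp add: \<alpha>_def x_def N_def)
  have "0 \<le> a j" "a j \<le> 1" for j using a[of j] by auto
  then have \<alpha>_range: "0 \<le> \<alpha>" "\<alpha> \<le> int N"
    using sum_mono[of "{..<N}" a "\<lambda>_. 1"] by (auto simp: \<alpha>_def intro: sum_nonneg)
  define E where "E = (int N - \<alpha>) * (\<beta> - n * int N) + int N * \<alpha>"
  define F where "F = (int N - \<beta>) * (\<alpha> - n * int N) + int N * \<beta>"
  have E: "\<bar>E\<bar> \<le> C * int N" and F: "\<bar>F\<bar> \<le> C * int N"
    using bound_a[of N] bound_b[of N] by (simp_all add: E_def F_def \<alpha>_def \<beta>_def)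
  \<comment> \<open>The products \<alpha>\<beta> cancel and a factor \<open>N\<close> remains;
    dividing it out turns the linear bounds into a constant one.\<close>
  have "E - F = int N * (n * (\<alpha> - \<beta>))"
    by (simp add: E_def F_def algebra_simps)
  then have "int N * (n * \<bar>\<alpha> - \<beta>\<bar>) = \<bar>E - F\<bar>"
    using n by (simp add: abs_mult)
  also have "\<dots> \<le> 2 * (C * int N)" using E F by linarith
  finally have "int N * (n * \<bar>\<alpha> - \<beta>\<bar>) \<le> int N * (2 * C)"
    by (simp add: mult.commute mult.left_commute)
  then have "n * \<bar>\<alpha> - \<beta>\<bar> \<le> 2 * C"
    using \<open>int N > 0\<close> by simp
  moreover have "\<bar>\<alpha> - \<beta>\<bar> \<le> n * \<bar>\<alpha> - \<beta>\<bar>"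
    using n mult_right_mono[of 1 n "\<bar>\<alpha> - \<beta>\<bar>"] by simp
  ultimately have close: "\<bar>\<alpha> - \<beta>\<bar> \<le> 2 * C" by simp
  \<comment> \<open>Replacing \<beta> by \<alpha> in \<open>E\<close> gives
    \<open>- (int k)\<^sup>2 * X\<close>.\<close>
  have "(int k)\<^sup>2 * X = (int N - \<alpha>) * (\<beta> - \<alpha>) - E"
    by (simp add: X_def E_def \<alpha> N_def power2_eq_square algebra_simps)
  then have "(int k)\<^sup>2 * \<bar>X\<bar> \<le> \<bar>(int N - \<alpha>) * (\<beta> - \<alpha>)\<bar> + \<bar>E\<bar>"
    by (metis abs_mult abs_power2 abs_triangle_ineq4)
  also have "\<bar>(int N - \<alpha>) * (\<beta> - \<alpha>)\<bar> \<le> int N * (2 * C)"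
    unfolding abs_mult using \<alpha>_range close by (intro mult_mono) auto
  finally have "int k * (int k * \<bar>X\<bar>) \<le> int k * (3 * C * int q)"
    using E by (simp add: N_def power2_eq_square algebra_simps)
  moreover have "int k > 0" using k \<open>C \<ge> 0\<close> by (simp add: add_nonneg_pos)
  ultimately have "int k * \<bar>X\<bar> \<le> 3 * C * int q" by simp
  then have "int k * \<bar>X\<bar> < int k * 1" using k by simp
  then have "X = 0" using \<open>int k > 0\<close> by (simp add: mult_less_cancel_left)
  then show False
    using metallic_quadratic_no_rational_root[of n "int q" x] n q by (simp add: X_def)
qed

lemma sum_square_bilinear:
  fixes a b :: "nat \<Rightarrow> int"
  shows "(\<Sum>i<N. \<Sum>j<N. (1 - a j) * (b i - n) + a j) =
    (int N - (\<Sum>j<N. a j)) * ((\<Sum>i<N. b i) - n * int N) + int N * (\<Sum>j<N. a j)"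
proof -
  have "(\<Sum>i<N. \<Sum>j<N. (1 - a j) * (b i - n)) = (\<Sum>j<N. 1 - a j) * (\<Sum>i<N. b i - n)"
    by (subst sum.swap) (rule sum_product[symmetric])
  then show ?thesis
    by (simp add: sum.distrib sum_subtractf mult.commute)
qed

text \<open>Telescoping leaves differences between opposite sides of the square: \<open>N\<close> of
  them for \<open>f\<close> and \<open>N\<close> for \<open>g\<close>.\<close>

lemma abs_square_flux_le:
  fixes f g :: "nat \<Rightarrow> nat \<Rightarrow> int"
  assumes f: "\<And>i j. 0 \<le> f i j \<and> f i j \<le> K" and g: "\<And>i j. 0 \<le> g i j \<and> g i j \<le> L"
  shows "\<bar>\<Sum>i<N. \<Sum>j<N. (f (Suc i) j - f i j) + (g i (Suc j) - g i j)\<bar> \<le> (K + L) * int N"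
proof -
  have "(\<Sum>i<N. \<Sum>j<N. f (Suc i) j - f i j) = (\<Sum>j<N. f N j - f 0 j)"
    by (subst sum.swap) (simp add: sum_lessThan_telescope[of "\<lambda>i. f i j" for j])
  moreover have "(\<Sum>i<N. \<Sum>j<N. g i (Suc j) - g i j) = (\<Sum>i<N. g i N - g i 0)"
    by (simp add: sum_lessThan_telescope)
  moreover have "\<bar>f N j - f 0 j\<bar> \<le> K" for j using f[of N j] f[of 0 j] by linarith
  then have "\<bar>\<Sum>j<N. f N j - f 0 j\<bar> \<le> K * int N"
    by (intro order_trans[OF sum_abs] order_trans[OF sum_bounded_above[where K = K]])
      (auto simp: mult.commute)
  moreover have "\<bar>g i N - g i 0\<bar> \<le> L" for i using g[of i N] g[of i 0] by linarith
  then have "\<bar>\<Sum>i<N. g i N - g i 0\<bar> \<le> L * int N"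
    by (intro order_trans[OF sum_abs] order_trans[OF sum_bounded_above[where K = L]])
      (auto simp: mult.commute)
  ultimately show ?thesis
    by (simp add: sum.distrib distrib_right)
qed

lemma metallic_mean_tile_labels_in_V:
  assumes "t \<in> metallic_mean_tiles n"
  shows "west t \<in> V n" "south t \<in> V n"
  using assms by (auto simp: metallic_mean_tiles_def)

lemma V_bounds:
  assumes "x \<in> V n"
  shows "fst x \<in> {0, 1}"
    and "0 \<le> fst (snd x) \<and> fst (snd x) \<le> 1"
    and "0 \<le> snd (snd x) \<and> snd (snd x) \<le> int n + 1"
  using assms by (auto simp: V_def)

lemma metallic_mean_tile_fst:
  assumes "t \<in> metallic_mean_tiles n"
  shows "fst (east t) = fst (west t)" "fst (north t) = fst (south t)"
  using assms by (auto simp: metallic_mean_tiles_def)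

lemma metallic_mean_tile_balance:
  assumes "t \<in> metallic_mean_tiles n"
  shows "(fst (snd (east t)) - fst (snd (west t))) + (snd (snd (north t)) - snd (snd (south t)))
      = (1 - fst (west t)) * (fst (south t) - int n) + fst (west t)"
    and "(snd (snd (east t)) - snd (snd (west t))) + (fst (snd (north t)) - fst (snd (south t)))
      = (1 - fst (south t)) * (fst (west t) - int n) + fst (south t)"
proof -
  obtain u0 u1 u2 v0 v1 v2 where
    t: "t = (theta n (u0, u1, u2) (v0, v1, v2), theta n (v0, v1, v2) (u0, u1, u2),
          (u0, u1, u2), (v0, v1, v2))"
    and V: "(u0, u1, u2) \<in> V n" "(v0, v1, v2) \<in> V n"
    using assms by (auto simp: metallic_mean_tiles_def)
  \<comment> \<open>In the first identity everything cancels for \<open>u0 = 0\<close>; for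
    \<open>u0 = 1\<close> the left side is \<open>2 - u1\<close>, and \<open>V n\<close> forces
    \<open>u1 = 1\<close>. The second exchanges \<open>u\<close> and \<open>v\<close>.\<close>
  have "u0 = 0 \<or> u0 = 1 \<and> u1 = 1" "v0 = 0 \<or> v0 = 1 \<and> v1 = 1"
    using V by (auto simp: V_def)
  then show "(fst (snd (east t)) - fst (snd (west t))) + (snd (snd (north t)) - snd (snd (south t)))
      = (1 - fst (west t)) * (fst (south t) - int n) + fst (west t)"
    and "(snd (snd (east t)) - snd (snd (west t))) + (fst (snd (north t)) - fst (snd (south t)))
      = (1 - fst (south t)) * (fst (west t) - int n) + fst (south t)"
    unfolding t by auto
qed

lemma int_shift_invariant_const:
  fixes f :: "int \<Rightarrow> 'a"
  assumes "\<And>i. f (i + 1) = f i"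
  shows "f i = f 0"
proof (induction i rule: int_induct[where k = 0])
  case (step2 i)
  then show ?case using assms[of "i - 1"] by simp
qed (use assms in auto)

text \<open>Coordinates of a period vector may be negative, while the density argument runs over
  naturals.\<close>

lemma periodic_nonneg_shift:
  fixes f :: "int \<Rightarrow> 'a"
  assumes "\<And>j. f (j + p) = f j"
  shows "f (int (j + nat \<bar>p\<bar>)) = f (int j)"
  using assms[of "int j"] assms[of "int j - p"] by (cases "p \<ge> 0") auto

theorem theorem4p3:
  fixes n :: nat
  assumes "n \<ge> 1"
  shows "\<not> (\<exists>w. valid_configuration (metallic_mean_tiles n) w \<and> periodic w)"
proof
  assume "\<exists>w. valid_configuration (metallic_mean_tiles n) w \<and> periodic w"
  then obtain w p where valid: "valid_configuration (metallic_mean_tiles n) w"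
    and "p \<noteq> 0" and p: "\<And>m. w (m + p) = w m"
    unfolding periodic_def by blast
  obtain p1 p2 where p_eq: "p = (p1, p2)" by (cases p)
  have tile: "w m \<in> metallic_mean_tiles n" for m
    using valid unfolding valid_configuration_def by blast
  have east: "east (w (i, j)) = west (w (i + 1, j))"
    and north: "north (w (i, j)) = south (w (i, j + 1))" for i j
    using valid by (auto simp: valid_configuration_def)
  define a where "a j = fst (west (w (0, j)))" for j
  define b where "b i = fst (south (w (i, 0)))" for i
  have a: "fst (west (w (i, j))) = a j" for i j
    unfolding a_def
    by (rule int_shift_invariant_const[of "\<lambda>i. fst (west (w (i, j)))"])
      (metis east metallic_mean_tile_fst(1) tile)
  have b: "fst (south (w (i, j))) = b i" for i j
    unfolding b_def
    by (rule int_shift_invariant_const[of "\<lambda>j. fst (south (w (i, j)))"])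
      (metis north metallic_mean_tile_fst(2) tile)
  \<comment> \<open>The horizontal part \<open>p1\<close> of the shift is harmless because
    \<open>a\<close> does not depend on the column.\<close>
  have a_period: "a (j + p2) = a j" for j
    using p[of "(0, j)"] a[of p1 "j + p2"] a[of 0 j] by (simp add: p_eq)
  have b_period: "b (i + p1) = b i" for i
    using p[of "(i, 0)"] b[of "i + p1" p2] b[of i 0] by (simp add: p_eq)
  note range = V_bounds[OF metallic_mean_tile_labels_in_V(1)[OF tile]]
    V_bounds[OF metallic_mean_tile_labels_in_V(2)[OF tile]]
  have a01: "a j \<in> {0, 1}" and b01: "b j \<in> {0, 1}" for j
    unfolding a_def b_def by (rule range)+
  \<comment> \<open>The ranges of the middle and last label components have lengths \<open>1\<close>
    and \<open>n + 1\<close>.\<close>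
  define C where "C = int n + 2"
  let ?A = "\<lambda>N. \<Sum>j<N. a (int j)" and ?B = "\<lambda>N. \<Sum>i<N. b (int i)"
  have bound_a: "\<bar>(int N - ?A N) * (?B N - int n * int N) + int N * ?A N\<bar> \<le> C * int N" for N
  proof -
    let ?f = "\<lambda>i j. fst (snd (west (w (int i, int j))))"
    let ?g = "\<lambda>i j. snd (snd (south (w (int i, int j))))"
    have balance: "(?f (Suc i) j - ?f i j) + (?g i (Suc j) - ?g i j)
        = (1 - a (int j)) * (b (int i) - int n) + a (int j)" for i j
      using metallic_mean_tile_balance(1)[OF tile, of "(int i, int j)"]
      by (simp add: east north a b add.commute)
    have "1 + (int n + 1) = C" by (simp add: C_def)
    with abs_square_flux_le[of ?f 1 ?g "int n + 1" N, OF range(2) range(6)] show ?thesis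
      by (simp only: balance sum_square_bilinear[of "\<lambda>j. a (int j)" "\<lambda>i. b (int i)"])
  qed
  have bound_b: "\<bar>(int N - ?B N) * (?A N - int n * int N) + int N * ?B N\<bar> \<le> C * int N" for N
  proof -
    let ?f = "\<lambda>i j. snd (snd (west (w (int i, int j))))"
    let ?g = "\<lambda>i j. fst (snd (south (w (int i, int j))))"
    have balance: "(?f (Suc i) j - ?f i j) + (?g i (Suc j) - ?g i j)
        = (1 - b (int i)) * (a (int j) - int n) + b (int i)" for i j
      using metallic_mean_tile_balance(2)[OF tile, of "(int i, int j)"]
      by (simp add: east north a b add.commute)
    have "int n + 1 + 1 = C" by (simp add: C_def)
    with abs_square_flux_le[of ?f "int n + 1" ?g 1 N, OF range(3) range(5)] show ?thesis
      \<comment> \<open>The roles of rows and columns are exchanged here, so the row index must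
        become the outer one.\<close>
      by (simp only: balance sum.swap[of _ "{..<N}" "{..<N}"]
          sum_square_bilinear[of "\<lambda>i. b (int i)" "\<lambda>j. a (int j)"])
  qed
  have "p1 \<noteq> 0 \<or> p2 \<noteq> 0"
    using \<open>p \<noteq> 0\<close> by (auto simp: p_eq zero_prod_def)
  \<comment> \<open>A nonzero \<open>p2\<close> gives a period of \<open>a\<close>, a nonzero
    \<open>p1\<close> one of \<open>b\<close>; the second case swaps the sequences and their
    bounds.\<close>
  then show False
  proof
    assume "p2 \<noteq> 0"
    then have "nat \<bar>p2\<bar> > 0" by simp
    moreover have "int n \<ge> 1" using assms by simp
    ultimately show False
      using no_periodic_balanced_sequences[of "int n" "nat \<bar>p2\<bar>" "\<lambda>j. a (int j)",
          OF _ _ periodic_nonneg_shift[of a, OF a_period] a01 bound_a bound_b]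
      by blast
  next
    assume "p1 \<noteq> 0"
    then have "nat \<bar>p1\<bar> > 0" by simp
    moreover have "int n \<ge> 1" using assms by simp
    ultimately show False
      using no_periodic_balanced_sequences[of "int n" "nat \<bar>p1\<bar>" "\<lambda>i. b (int i)",
          OF _ _ periodic_nonneg_shift[of b, OF b_period] b01 bound_b bound_a]
      by blast
  qed
qed

end
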